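(* Let $\alpha^*(K)$ denote the quantity $\alpha^*$ defined in the context for a positive integer $K$. Then (a) $\alpha^*(4)\ge\frac{5+\sqrt5}{10}\approx0.7236$, and (b) $\alpha^*(6)\ge0.74$.
   Context: Fix a positive integer $K$. For $b=(b_1,\dots,b_{K-1})$ with $b_K=0$, let $\beta(b)$ be the infimum of $\beta$ over real variables $U_{00},R_{00},\beta$ and $U'_{IJ},R'_{IJ}$ ($I,J=1,\dots,K$) subject to: $U_{00}R_{00}+\tfrac12\sum_{I=1}^K\sum_{J=1}^{K+1-I}U'_{IJ}R'_{IJ}=U_{00}+\tfrac12\sum_{I=1}^K\sum_{J=1}^{K+1-I}U'_{IJ}$; for each $k=1,\dots,K$: $U_{00}R_{00}+\sum_{I=1}^k\sum_{J=1}^{K+1-k}U'_{IJ}R'_{IJ}\le\beta\big(U_{00}+\sum_{I=1}^k\sum_{J=1}^{K+1-k}U'_{IJ}\big)$; $R_{00}\ge0$, $R'_{11}\ge b_1$, $R'_{1J}\ge b_J$ and $R'_{I1}\ge b_I$ for $I,J=2,\dots,K$, $b_{I-1}+b_{J-1}\ge R'_{IJ}\ge b_I+b_J$ for all $I,J=2,\dots,K$; $U_{00}\ge1$, $U'_{IJ}\ge0$ for all $I,J$. Define $\alpha^*(K)$ as the maximum of $\min\{\beta(b),\max_{k=1,\dots,K}(b_k+b_{K+1-k})\}$ over all $b$ satisfying $b_k+b_{K-k}\le1$ for $k=1,\dots,K-1$ and $b_k\ge b_{k+1}\ge0$ for $k=1,\dots,K-1$, where $b_K=0$. *)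

theory Defs
  imports "HOL-Analysis.Analysis"
begin

text \<open>
  Vectors \<open>b = (b\<^sub>1, \<dots>, b\<^sub>K)\<close> and arrays \<open>(U'\<^sub>I\<^sub>J)\<close>, \<open>(R'\<^sub>I\<^sub>J)\<close>, \<open>1 \<le> I, J \<le> K\<close>, are functions
  on the natural numbers; values at indices outside \<open>{1..K}\<close> are never used.
\<close>

definition feasible ::
  "nat \<Rightarrow> (nat \<Rightarrow> real) \<Rightarrow> real \<Rightarrow> real \<Rightarrow> (nat \<Rightarrow> nat \<Rightarrow> real) \<Rightarrow> (nat \<Rightarrow> nat \<Rightarrow> real) \<Rightarrow> real \<Rightarrow> bool"
where
  "feasible K b U00 R00 U' R' \<beta> \<longleftrightarrow>
     U00 * R00 + 1/2 * (\<Sum>I=1..K. \<Sum>J=1..K+1-I. U' I J * R' I J)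
       = U00 + 1/2 * (\<Sum>I=1..K. \<Sum>J=1..K+1-I. U' I J) \<and>
     (\<forall>k\<in>{1..K}. U00 * R00 + (\<Sum>I=1..k. \<Sum>J=1..K+1-k. U' I J * R' I J)
       \<le> \<beta> * (U00 + (\<Sum>I=1..k. \<Sum>J=1..K+1-k. U' I J))) \<and>
     R00 \<ge> 0 \<and>
     R' 1 1 \<ge> b 1 \<and>
     (\<forall>J\<in>{2..K}. R' 1 J \<ge> b J) \<and>
     (\<forall>I\<in>{2..K}. R' I 1 \<ge> b I) \<and>
     (\<forall>I\<in>{2..K}. \<forall>J\<in>{2..K}. b (I-1) + b (J-1) \<ge> R' I J \<and> R' I J \<ge> b I + b J) \<and>
     U00 \<ge> 1 \<and>
     (\<forall>I\<in>{1..K}. \<forall>J\<in>{1..K}. U' I J \<ge> 0)"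

definition beta_opt :: "nat \<Rightarrow> (nat \<Rightarrow> real) \<Rightarrow> real" where
  "beta_opt K b = Inf {\<beta>. \<exists>U00 R00 U' R'. feasible K b U00 R00 U' R' \<beta>}"

definition admissible :: "nat \<Rightarrow> (nat \<Rightarrow> real) set" where
  "admissible K = {b. b K = 0 \<and>
     (\<forall>k\<in>{1..K-1}. b k + b (K-k) \<le> 1) \<and>
     (\<forall>k\<in>{1..K-1}. b k \<ge> b (k+1) \<and> b (k+1) \<ge> 0)}"

definition objective :: "nat \<Rightarrow> (nat \<Rightarrow> real) \<Rightarrow> real" where
  "objective K b = min (beta_opt K b) (MAX k\<in>{1..K}. b k + b (K+1-k))"

text \<open>
  The supremum is a maximum, and the infimum above ranges over a nonempty set that is bounded below;
  see \<open>alpha_star_is_maximum\<close>, \<open>feasible_nonempty\<close> and \<open>feasible_bdd_below\<close>.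
\<close>

definition alpha_star :: "nat \<Rightarrow> real" where
  "alpha_star K = (SUP b\<in>admissible K. objective K b)"


lemma admissible_antimono:
  assumes "b \<in> admissible K" "1 \<le> i" "i \<le> j" "j \<le> K"
  shows "b j \<le> b i"
  using assms(3,4)
proof (induction j rule: dec_induct)
  case (step n)
  then have "b (n+1) \<le> b n" using assms(1,2) by (auto simp: admissible_def)
  then show ?case using step by simp
qed simp

lemma admissible_nonneg:
  assumes "b \<in> admissible K" "1 \<le> i" "i \<le> K"
  shows "0 \<le> b i"
  using admissible_antimono[OF assms order_refl] assms(1) by (simp add: admissible_def)

lemma feasible_nonneg:
  assumes b: "b \<in> admissible K" and K: "K \<ge> 1" and f: "feasible K b U00 R00 U' R' \<beta>"
  shows "0 \<le> \<beta>"
proof -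
  have nn: "0 \<le> U' I J \<and> 0 \<le> R' I J" if "I \<in> {1..K}" "J \<in> {1..K}" for I J
  proof -
    have "b I \<ge> 0" "b J \<ge> 0" using admissible_nonneg[OF b] that by auto
    moreover have "R' I J \<ge> b I \<or> R' I J \<ge> b J \<or> R' I J \<ge> b I + b J"
    proof -
      have "I = 1 \<or> I \<in> {2..K}" "J = 1 \<or> J \<in> {2..K}" using that by auto
      then show ?thesis using f unfolding feasible_def by blast
    qed
    ultimately have "0 \<le> R' I J" by linarith
    then show ?thesis using f that unfolding feasible_def by blast
  qed
  have c: "U00 * R00 + (\<Sum>I=1..1. \<Sum>J=1..K. U' I J * R' I J)
       \<le> \<beta> * (U00 + (\<Sum>I=1..1. \<Sum>J=1..K. U' I J))"
  proof -
    have "\<forall>k\<in>{1..K}. U00 * R00 + (\<Sum>I=1..k. \<Sum>J=1..K+1-k. U' I J * R' I J)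
       \<le> \<beta> * (U00 + (\<Sum>I=1..k. \<Sum>J=1..K+1-k. U' I J))"
      using f unfolding feasible_def by blast
    from bspec[OF this, of 1] show ?thesis using K by simp
  qed
  have "0 \<le> (\<Sum>J=1..K. U' 1 J * R' 1 J)" "0 \<le> (\<Sum>J=1..K. U' 1 J)"
    using nn K by (auto intro!: sum_nonneg mult_nonneg_nonneg)
  moreover have "U00 \<ge> 1" "0 \<le> U00 * R00" using f by (auto simp: feasible_def)
  ultimately have "0 \<le> \<beta> * (U00 + (\<Sum>J=1..K. U' 1 J))" "U00 + (\<Sum>J=1..K. U' 1 J) > 0"
    using c by auto
  then show ?thesis by (simp add: zero_le_mult_iff)
qed

lemma feasible_bdd_below:
  assumes "b \<in> admissible K" "K \<ge> 1"
  shows "bdd_below {\<beta>. \<exists>U00 R00 U' R'. feasible K b U00 R00 U' R' \<beta>}"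
  using feasible_nonneg[OF assms] by (auto intro!: bdd_belowI[of _ 0])

lemma feasible_one:
  assumes b: "b \<in> admissible K" and K: "K \<ge> 1"
  shows "\<exists>U00 R00 U' R'. feasible K b U00 R00 U' R' 1"
proof -
  have "feasible K b 1 1 (\<lambda>I J. 0)
          (\<lambda>I J. if I = 1 \<and> J = 1 then b 1 else if I = 1 then b J else if J = 1 then b I else b I + b J) 1"
    using admissible_antimono[OF b] unfolding feasible_def by (auto intro!: add_mono)
  then show ?thesis by blast
qed

lemma feasible_nonempty:
  assumes "b \<in> admissible K" "K \<ge> 1"
  shows "{\<beta>. \<exists>U00 R00 U' R'. feasible K b U00 R00 U' R' \<beta>} \<noteq> {}"
  using feasible_one[OF assms] by blast

lemma beta_opt_le:
  assumes "b \<in> admissible K" "K \<ge> 1" "feasible K b U00 R00 U' R' \<beta>"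
  shows "beta_opt K b \<le> \<beta>"
  unfolding beta_opt_def
  by (rule cInf_lower[OF _ feasible_bdd_below[OF assms(1,2)]]) (use assms(3) in blast)

lemma beta_opt_usc:
  assumes b: "b \<in> admissible K" and K: "K \<ge> 1" and c: "beta_opt K b < c"
  shows "\<exists>T. open T \<and> b \<in> T \<and> (\<forall>d\<in>T \<inter> admissible K. beta_opt K d < c)"
proof -
  obtain \<beta> U00 R00 U' R' where f: "feasible K b U00 R00 U' R' \<beta>" and "\<beta> < c"
    using cInf_lessD[OF feasible_nonempty[OF b K]] c unfolding beta_opt_def by blast
  then obtain e where e: "\<beta> < e" "e < c" using dense by blast
  have "0 \<le> \<beta>" using feasible_nonneg[OF b K f] .
  have U: "U00 \<ge> 1" "R00 \<ge> 0" "\<And>I J. I \<in> {1..K} \<Longrightarrow> J \<in> {1..K} \<Longrightarrow> 0 \<le> U' I J"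
    using f by (auto simp: feasible_def)
  define R where "R d I J =
    (if I = 1 \<and> J = 1 then max (R' I J) (d 1)
     else if I = 1 then max (R' I J) (d J)
     else if J = 1 then max (R' I J) (d I)
     else max (d I + d J) (min (R' I J) (d (I-1) + d (J-1))))" for d :: "nat \<Rightarrow> real" and I J
  have cont_coord: "continuous_on UNIV (\<lambda>d::nat\<Rightarrow>real. d i)" for i
    by (rule continuous_on_product_coordinates)
  have contR: "continuous_on UNIV (\<lambda>d. R d I J)" for I J
    unfolding R_def by (cases "I = 1"; cases "J = 1")
      (auto intro!: continuous_intros continuous_on_max continuous_on_min cont_coord)
  have Rb: "R b I J = R' I J" if "I \<in> {1..K}" "J \<in> {1..K}" for I J
  proof -
    have "I = 1 \<or> I \<in> {2..K}" "J = 1 \<or> J \<in> {2..K}" using that by auto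
    then show ?thesis using f unfolding feasible_def R_def by (elim disjE) auto
  qed
  define E where "E d = U00 * R00 + 1/2 * (\<Sum>I=1..K. \<Sum>J=1..K+1-I. U' I J * R d I J)
      - (U00 + 1/2 * (\<Sum>I=1..K. \<Sum>J=1..K+1-I. U' I J))" for d
  define V where "V d = U00 + max 0 (E d)" for d
  define W where "W d = U00 * R00 + max 0 (- E d)" for d
  define G where "G k d = W d + (\<Sum>I=1..k. \<Sum>J=1..K+1-k. U' I J * R d I J)
      - e * (V d + (\<Sum>I=1..k. \<Sum>J=1..K+1-k. U' I J))" for k d
  have contE: "continuous_on UNIV E"
    unfolding E_def by (intro continuous_intros contR)
  have contG: "continuous_on UNIV (G k)" for k
    unfolding G_def V_def W_def by (intro continuous_intros contR contE continuous_on_max)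
  have Eb: "E b = 0"
  proof -
    have "(\<Sum>I=1..K. \<Sum>J=1..K+1-I. U' I J * R b I J) = (\<Sum>I=1..K. \<Sum>J=1..K+1-I. U' I J * R' I J)"
      by (intro sum.cong refl) (auto simp: Rb)
    then show ?thesis using f unfolding E_def feasible_def by simp
  qed
  have Gb: "G k b < 0" if k: "k \<in> {1..K}" for k
  proof -
    have 1: "(\<Sum>I=1..k. \<Sum>J=1..K+1-k. U' I J * R b I J) = (\<Sum>I=1..k. \<Sum>J=1..K+1-k. U' I J * R' I J)"
      using k by (intro sum.cong refl) (auto simp: Rb)
    define S where "S = U00 + (\<Sum>I=1..k. \<Sum>J=1..K+1-k. U' I J)"
    have "0 \<le> (\<Sum>I=1..k. \<Sum>J=1..K+1-k. U' I J)"
      using k by (intro sum_nonneg U) auto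
    then have "S > 0" using U unfolding S_def by linarith
    then have "\<beta> * S < e * S" using e by simp
    moreover have "U00 * R00 + (\<Sum>I=1..k. \<Sum>J=1..K+1-k. U' I J * R' I J) \<le> \<beta> * S"
      using f k unfolding feasible_def S_def by blast
    ultimately show ?thesis unfolding G_def V_def W_def 1 Eb S_def by simp
  qed
  define T where "T = (\<Inter>k\<in>{1..K}. {d. G k d < 0})"
  have "open T" unfolding T_def
    by (intro open_INT ballI open_Collect_less contG continuous_intros) auto
  moreover have "b \<in> T" using Gb by (auto simp: T_def)
  moreover have "beta_opt K d < c" if d: "d \<in> T" "d \<in> admissible K" for d
  proof -
    have V: "V d \<ge> 1" using U by (auto simp: V_def)
    have VW: "V d * (W d / V d) = W d" using V by simp
    have W0: "W d \<ge> 0" using U by (auto simp: W_def)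
    have "feasible K d (V d) (W d / V d) U' (R d) e"
      unfolding feasible_def VW
    proof (intro conjI ballI)
      show "W d + 1/2 * (\<Sum>I=1..K. \<Sum>J=1..K+1-I. U' I J * R d I J)
        = V d + 1/2 * (\<Sum>I=1..K. \<Sum>J=1..K+1-I. U' I J)"
        unfolding V_def W_def E_def by (simp add: max_def)
      show "W d + (\<Sum>I=1..k. \<Sum>J=1..K+1-k. U' I J * R d I J)
        \<le> e * (V d + (\<Sum>I=1..k. \<Sum>J=1..K+1-k. U' I J))" if "k \<in> {1..K}" for k
      proof -
        have "G k d < 0" using d that by (auto simp: T_def)
        then show ?thesis unfolding G_def by linarith
      qed
      show "R d I J \<le> d (I-1) + d (J-1)" if "I \<in> {2..K}" "J \<in> {2..K}" for I J
      proof -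
        have "d I \<le> d (I-1)" "d J \<le> d (J-1)"
          using that by (auto intro!: admissible_antimono[OF d(2)])
        then show ?thesis using that by (auto simp: R_def)
      qed
    qed (use V W0 U in \<open>auto simp: R_def\<close>)
    then show ?thesis using beta_opt_le[OF d(2) K] e by fastforce
  qed
  ultimately show ?thesis by blast
qed

lemma alpha_star_is_maximum:
  assumes K: "K \<ge> 1"
  shows "\<exists>b\<in>admissible K. objective K b = alpha_star K \<and> (\<forall>d\<in>admissible K. objective K d \<le> alpha_star K)"
proof -
  have bdd: "bdd_above (objective K ` admissible K)"
  proof (rule bdd_aboveI2)
    fix b assume b: "b \<in> admissible K"
    have "beta_opt K b \<le> 1" using feasible_one[OF b K] beta_opt_le[OF b K] by blast
    then show "objective K b \<le> 1" unfolding objective_def by simp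
  qed
  have ub: "objective K d \<le> alpha_star K" if "d \<in> admissible K" for d
    unfolding alpha_star_def using that bdd by (rule cSUP_upper)
  \<comment> \<open>normalising the unused values to 0 makes the admissible set compact\<close>
  define C where "C = {b \<in> admissible K. \<forall>i. i \<notin> {1..K} \<longrightarrow> b i = 0}"
  define r where "r b i = (if i \<in> {1..K} then b i else 0)" for b :: "nat \<Rightarrow> real" and i
  have r_adm: "r b \<in> C" if "b \<in> admissible K" for b
    using that K by (auto simp: C_def admissible_def r_def)
  have r_obj: "objective K (r b) = objective K b" for b
  proof -
    have "feasible K (r b) u v w x y = feasible K b u v w x y" for u v w x y
      using K unfolding feasible_def
      by (intro arg_cong2[of _ _ _ _ "(\<and>)"] ball_cong refl) (auto simp: r_def)
    moreover have "(MAX k\<in>{1..K}. r b k + r b (K+1-k)) = (MAX k\<in>{1..K}. b k + b (K+1-k))"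
      by (intro arg_cong[of _ _ Max] image_cong) (auto simp: r_def)
    ultimately show ?thesis unfolding objective_def beta_opt_def by simp
  qed
  have le1: "b i \<le> 1" if "b \<in> C" for b i
  proof (cases "i \<in> {1..K-1}")
    case True
    then have "b i + b (K-i) \<le> 1" "0 \<le> b (K-i)"
      using that admissible_nonneg[of b K "K-i"] by (auto simp: C_def admissible_def)
    then show ?thesis by linarith
  next
    case False
    then have "i = K \<or> i \<notin> {1..K}" by auto
    then show ?thesis using that by (auto simp: C_def admissible_def)
  qed
  have ge0: "0 \<le> b i" if "b \<in> C" for b i
    using that admissible_nonneg[of b K i] by (cases "i \<in> {1..K}") (auto simp: C_def)
  have cont_coord: "continuous_on UNIV (\<lambda>d::nat\<Rightarrow>real. d i)" for i
    by (rule continuous_on_product_coordinates)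
  have "compact (Pi\<^sub>E UNIV (\<lambda>i::nat. {0..1::real}))"
    unfolding compactin_euclidean_iff[symmetric] euclidean_product_topology[symmetric] compactin_PiE by simp
  moreover have "closed C"
  proof -
    have "C = {b. b K = 0} \<inter> (\<Inter>k\<in>{1..K-1}. {b. b k + b (K-k) \<le> 1}) \<inter>
      (\<Inter>k\<in>{1..K-1}. {b. b (k+1) \<le> b k}) \<inter> (\<Inter>k\<in>{1..K-1}. {b. 0 \<le> b (k+1)}) \<inter>
      (\<Inter>i\<in>-{1..K}. {b. b i = 0})"
      unfolding C_def admissible_def by blast
    then show ?thesis
      by (simp only:) (intro closed_Int closed_INT ballI closed_Collect_le closed_Collect_eq
          continuous_on_add continuous_on_const cont_coord)
  qed
  moreover have "C = Pi\<^sub>E UNIV (\<lambda>i::nat. {0..1::real}) \<inter> C"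
  proof -
    have "b \<in> Pi\<^sub>E UNIV (\<lambda>i::nat. {0..1::real})" if "b \<in> C" for b
      using le1[OF that] ge0[OF that] by (simp add: PiE_UNIV_domain)
    then show ?thesis by blast
  qed
  ultimately have comp: "compact C" by (metis compact_Int_closed)
  have "(\<lambda>_. 0) \<in> admissible K" by (auto simp: admissible_def)
  then have ne: "admissible K \<noteq> {}" by blast
  have "\<exists>b\<in>C. alpha_star K \<le> objective K b"
  proof (rule ccontr)
    assume "\<not> ?thesis"
    then have less: "objective K b < alpha_star K" if "b \<in> C" for b using that by force
    have "\<exists>T q. open T \<and> b \<in> T \<and> q < alpha_star K \<and> (\<forall>d\<in>T \<inter> C. objective K d < q)" if bC: "b \<in> C" for b
    proof -
      obtain q where q: "objective K b < q" "q < alpha_star K" using dense[OF less[OF bC]] by blast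
      have badm: "b \<in> admissible K" using bC by (simp add: C_def)
      show ?thesis
      proof (cases "beta_opt K b < q")
        case True
        from beta_opt_usc[OF badm K True] show ?thesis
          using q(2) unfolding objective_def C_def min_less_iff_disj by blast
      next
        case False
        then have m: "(MAX k\<in>{1..K}. b k + b (K+1-k)) < q"
          using q(1) by (auto simp: objective_def)
        define T where "T = (\<Inter>k\<in>{1..K}. {d::nat\<Rightarrow>real. d k + d (K+1-k) < q})"
        have "open T" unfolding T_def
          by (intro open_INT ballI open_Collect_less continuous_intros cont_coord) auto
        moreover have "b \<in> T" using m K by (auto simp: T_def)
        moreover have "objective K d < q" if "d \<in> T" for d
        proof -
          have "(MAX k\<in>{1..K}. d k + d (K+1-k)) < q"
            using that K by (subst Max_less_iff) (auto simp: T_def)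
          then show ?thesis by (simp add: objective_def)
        qed
        ultimately show ?thesis using q(2) by blast
      qed
    qed
    then obtain T q where T: "\<And>b. b \<in> C \<Longrightarrow> open (T b) \<and> b \<in> T b \<and> q b < alpha_star K \<and>
        (\<forall>d\<in>T b \<inter> C. objective K d < (q b :: real))" by metis
    obtain D where D: "D \<subseteq> C" "finite D" "C \<subseteq> (\<Union>b\<in>D. T b)"
      using compactE_image[OF comp, of C T] T by blast
    have "C \<noteq> {}" using ne r_adm by blast
    then have "D \<noteq> {}" using D by auto
    define p where "p = Max (q ` D)"
    have "p < alpha_star K" unfolding p_def using D T \<open>D \<noteq> {}\<close> by (subst Max_less_iff) auto
    moreover have "objective K d \<le> p" if d: "d \<in> admissible K" for d
    proof -
      obtain b where b: "b \<in> D" "r d \<in> T b" using D(3) r_adm[OF d] by blast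
      then have "objective K (r d) < q b" using T[of b] D(1) r_adm[OF d] by blast
      then have "objective K d < q b" by (simp only: r_obj)
      also have "q b \<le> p" unfolding p_def using D b by (auto intro: Max_ge)
      finally show ?thesis by simp
    qed
    then have "alpha_star K \<le> p" unfolding alpha_star_def using ne by (intro cSUP_least)
    ultimately show False by simp
  qed
  then obtain b where "b \<in> C" "alpha_star K \<le> objective K b" by blast
  then show ?thesis using ub by (force simp: C_def)
qed

end

theory Submission
  imports Defs
begin

text \<open>
  For fixed \<open>b\<close> and \<open>\<beta>\<close> the constraints are linear in the products \<open>U\<^sub>0\<^sub>0 R\<^sub>0\<^sub>0\<close>, \<open>U'\<^sub>I\<^sub>J R'\<^sub>I\<^sub>J\<close> and in
  \<open>U\<^sub>0\<^sub>0\<close>, \<open>U'\<^sub>I\<^sub>J\<close>, so \<open>\<beta>(b)\<close> can be bounded from below by linear programming duality: weight the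
  \<open>k\<close>-th inequality by \<open>\<lambda>\<^sub>k \<ge> 0\<close>, subtract the equality constraint, and compare coefficients cell by
  cell. The cell \<open>(I, J)\<close> lies in the \<open>k\<close>-th rectangle iff \<open>I \<le> k \<le> K + 1 - J\<close>, so it receives the
  total weight \<open>\<lambda>\<^sub>I + \<dots> + \<lambda>\<^bsub>K+1-J\<^esub>\<close>.

  For every \<open>K \<ge> 4\<close> the vector \<open>b = (3/4, 3/8, 0, \<dots>, 0)\<close> with weights \<open>1/2\<close> at \<open>k = 1, K\<close> and
  \<open>1/6\<close> at \<open>k = 2, K - 1\<close> certifies \<open>\<beta>(b) \<ge> 3/4 = b\<^sub>1 + b\<^sub>K\<close>. Hence \<open>\<alpha>\<^sup>*(K) \<ge> 3/4\<close>, which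
  exceeds both \<open>(5 + \<surd>5)/10\<close> and \<open>0.74\<close>.
\<close>

text \<open>From I <= k and J <= K+1-k follows I+J <= K+1, so each rectangle lies in the triangle.
  The new index range is free of k, which lets the sums be exchanged.\<close>

lemma sum_rectangle_eq_sum_triangle:
  fixes f :: "nat \<Rightarrow> nat \<Rightarrow> 'a::comm_monoid_add"
  assumes "k \<in> {1..K}"
  shows "(\<Sum>I=1..k. \<Sum>J=1..K+1-k. f I J)
    = (\<Sum>I=1..K. \<Sum>J=1..K+1-I. if k \<in> {I..K+1-J} then f I J else 0)"
proof -
  have "(\<Sum>I=1..K. \<Sum>J=1..K+1-I. if k \<in> {I..K+1-J} then f I J else 0)
      = (\<Sum>I=1..k. \<Sum>J=1..K+1-I. if k \<in> {I..K+1-J} then f I J else 0)"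
    using assms by (intro sum.mono_neutral_right) (auto intro!: sum.neutral)
  also have "\<dots> = (\<Sum>I=1..k. \<Sum>J=1..K+1-k. f I J)"
    using assms by (intro sum.cong refl sum.mono_neutral_cong_right) auto
  finally show ?thesis by simp
qed

lemma weighted_sum_rectangles:
  fixes f :: "nat \<Rightarrow> nat \<Rightarrow> real"
  shows "(\<Sum>k=1..K. lam k * (\<Sum>I=1..k. \<Sum>J=1..K+1-k. f I J))
    = (\<Sum>I=1..K. \<Sum>J=1..K+1-I. (\<Sum>k=I..K+1-J. lam k) * f I J)"
proof -
  have "(\<Sum>k=1..K. lam k * (\<Sum>I=1..k. \<Sum>J=1..K+1-k. f I J))
      = (\<Sum>k=1..K. \<Sum>I=1..K. \<Sum>J=1..K+1-I. if k \<in> {I..K+1-J} then lam k * f I J else 0)"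
    by (rule sum.cong[OF refl], subst sum_rectangle_eq_sum_triangle)
       (auto simp: sum_distrib_left intro!: sum.cong)
  also have "\<dots> = (\<Sum>I=1..K. \<Sum>J=1..K+1-I. \<Sum>k=1..K. if k \<in> {I..K+1-J} then lam k * f I J else 0)"
    by (subst sum.swap) (intro sum.cong refl sum.swap)
  also have "\<dots> = (\<Sum>I=1..K. \<Sum>J=1..K+1-I. (\<Sum>k=I..K+1-J. lam k) * f I J)"
    unfolding sum_distrib_right
    by (intro sum.cong refl sum.mono_neutral_cong_right) auto
  finally show ?thesis .
qed

text \<open>The entries of \<open>R'\<close> are variables too, so each cell condition must hold for
  every permitted value r. In the first row and column r is unbounded above, which forces
  \<open>cell\<close> >= 1/2 there; inner cells may carry less weight because r is bounded
  above.\<close>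

lemma feasible_ge_dual:
  fixes lam :: "nat \<Rightarrow> real" and K :: nat
  defines "cell I J \<equiv> \<Sum>k=I..K+1-J. lam k"
  assumes f: "feasible K b U00 R00 U' R' \<beta>"
    and lam: "\<And>k. k \<in> {1..K} \<Longrightarrow> 0 \<le> lam k"
    and total: "1 \<le> (\<Sum>k=1..K. lam k)" "a * (\<Sum>k=1..K. lam k) \<le> 1"
    and first_row: "\<And>J r. J \<in> {1..K} \<Longrightarrow> b J \<le> r \<Longrightarrow> a * cell 1 J - 1/2 \<le> r * (cell 1 J - 1/2)"
    and first_column: "\<And>I r. I \<in> {2..K} \<Longrightarrow> b I \<le> r \<Longrightarrow> a * cell I 1 - 1/2 \<le> r * (cell I 1 - 1/2)"
    and inner: "\<And>I J r. I \<in> {2..K} \<Longrightarrow> J \<in> {2..K} \<Longrightarrow> I + J \<le> K + 1 \<Longrightarrow>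
      r \<le> b (I-1) + b (J-1) \<Longrightarrow> b I + b J \<le> r \<Longrightarrow> a * cell I J - 1/2 \<le> r * (cell I J - 1/2)"
  shows "a \<le> \<beta>"
proof -
  define s where "s = (\<Sum>k=1..K. lam k)"
  define W where "W I J = U' I J * R' I J" for I J
  define tri where "tri g = (\<Sum>I=1..K. \<Sum>J=1..K+1-I. g I J)" for g :: "nat \<Rightarrow> nat \<Rightarrow> real"
  define P where "P = s * U00 + tri (\<lambda>I J. cell I J * U' I J)"
  have U: "U00 \<ge> 1" "R00 \<ge> 0" and U': "\<And>I J. I \<in> {1..K} \<Longrightarrow> J \<in> {1..K} \<Longrightarrow> 0 \<le> U' I J"
    and eq: "U00 * R00 + 1/2 * tri W = U00 + 1/2 * tri U'"
    and le: "\<And>k. k \<in> {1..K} \<Longrightarrow> U00 * R00 + (\<Sum>I=1..k. \<Sum>J=1..K+1-k. W I J)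
       \<le> \<beta> * (U00 + (\<Sum>I=1..k. \<Sum>J=1..K+1-k. U' I J))"
    using f unfolding feasible_def tri_def W_def by auto
  have cell_bound: "a * cell I J - 1/2 \<le> R' I J * (cell I J - 1/2)"
    if IJ: "I \<in> {1..K}" "J \<in> {1..K+1-I}" for I J
  proof -
    consider "I = 1" "J \<in> {1..K}" | "I \<in> {2..K}" "J = 1"
      | "I \<in> {2..K}" "J \<in> {2..K}" "I + J \<le> K + 1"
      using IJ by (cases "I = 1"; cases "J = 1") auto
    then show ?thesis
    proof cases
      case 1
      then have "b J \<le> R' 1 J" using f unfolding feasible_def by (cases "J = 1") auto
      then show ?thesis using first_row 1 by simp
    next
      case 2
      then have "b I \<le> R' I 1" using f unfolding feasible_def by auto
      then show ?thesis using first_column 2 by simp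
    next
      case 3
      then have "R' I J \<le> b (I-1) + b (J-1)" "b I + b J \<le> R' I J"
        using f unfolding feasible_def by blast+
      then show ?thesis by (rule inner[OF 3])
    qed
  qed
  have "(\<Sum>k=1..K. lam k * (U00 * R00 + (\<Sum>I=1..k. \<Sum>J=1..K+1-k. W I J)))
      \<le> (\<Sum>k=1..K. lam k * (\<beta> * (U00 + (\<Sum>I=1..k. \<Sum>J=1..K+1-k. U' I J))))"
    by (intro sum_mono mult_left_mono le lam)
  \<comment> \<open>Applied both to \<open>W\<close> with \<open>U00 * R00\<close> and to
    \<open>U'\<close> with \<open>U00\<close>.\<close>
  moreover have "(\<Sum>k=1..K. lam k * (c + (\<Sum>I=1..k. \<Sum>J=1..K+1-k. g I J)))
      = s * c + tri (\<lambda>I J. cell I J * g I J)" for c g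
    unfolding tri_def cell_def s_def weighted_sum_rectangles[symmetric]
    by (simp add: distrib_left sum.distrib sum_distrib_right)
  moreover have "(\<Sum>k=1..K. lam k * (\<beta> * h k)) = \<beta> * (\<Sum>k=1..K. lam k * h k)" for h
    by (simp add: sum_distrib_left mult.left_commute)
  ultimately have weighted: "s * (U00 * R00) + tri (\<lambda>I J. cell I J * W I J) \<le> \<beta> * P"
    unfolding P_def by simp
  have "tri (\<lambda>I J. U' I J * (a * cell I J - 1/2)) \<le> tri (\<lambda>I J. U' I J * (R' I J * (cell I J - 1/2)))"
    unfolding tri_def by (intro sum_mono mult_left_mono cell_bound U') auto
  moreover have "tri (\<lambda>I J. U' I J * (a * cell I J - 1/2))
      = a * tri (\<lambda>I J. cell I J * U' I J) - 1/2 * tri U'"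
    unfolding tri_def sum_distrib_left sum_subtractf[symmetric]
    by (intro sum.cong refl) (simp add: algebra_simps)
  moreover have "tri (\<lambda>I J. U' I J * (R' I J * (cell I J - 1/2)))
      = tri (\<lambda>I J. cell I J * W I J) - 1/2 * tri W"
    unfolding tri_def W_def sum_distrib_left sum_subtractf[symmetric]
    by (intro sum.cong refl) (simp add: algebra_simps)
  ultimately have "a * tri (\<lambda>I J. cell I J * U' I J) + U00
      \<le> tri (\<lambda>I J. cell I J * W I J) + U00 * R00"
    using eq by linarith
  \<comment> \<open>The cell (0,0) has weight s in the inequalities but 1 in the equality; the two
    bounds in \<open>total\<close> absorb the difference.\<close>
  moreover have "U00 * R00 \<le> s * (U00 * R00)"
    using mult_right_mono[of 1 s "U00 * R00"] total U unfolding s_def by simp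
  moreover have "a * s * U00 \<le> U00"
    using mult_right_mono[of "a * s" 1 U00] total U unfolding s_def by simp
  ultimately have "a * P \<le> \<beta> * P"
    using weighted unfolding P_def by (simp add: algebra_simps)
  moreover have "P > 0"
  proof -
    have "0 \<le> tri (\<lambda>I J. cell I J * U' I J)"
      unfolding tri_def cell_def by (intro sum_nonneg mult_nonneg_nonneg lam U') auto
    moreover have "0 < s * U00" using total U unfolding s_def by simp
    ultimately show ?thesis unfolding P_def by linarith
  qed
  ultimately show ?thesis by simp
qed

lemma alpha_star_ge_three_quarters:
  assumes K: "K \<ge> 4"
  shows "3/4 \<le> alpha_star K"
proof -
  define b :: "nat \<Rightarrow> real" where "b k = (if k = 1 then 3/4 else if k = 2 then 3/8 else 0)" for k
  \<comment> \<open>The total weight is 4/3, the reciprocal of 3/4. The cell conditions are sharp at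
    (1,2), (2,1), (2,2), (2,3) and (3,2). For K >= 4 the four weighted indices are distinct.\<close>
  define lam :: "nat \<Rightarrow> real" where
    "lam k = (if k = 1 then 1/2 else 0) + (if k = 2 then 1/6 else 0)
      + (if k = K - 1 then 1/6 else 0) + (if k = K then 1/2 else 0)" for k
  have b: "b \<in> admissible K" using K by (auto simp: admissible_def b_def)
  have sum_lam: "(\<Sum>k=m..n. lam k) = (if m \<le> 1 \<and> 1 \<le> n then 1/2 else 0)
      + (if m \<le> 2 \<and> 2 \<le> n then 1/6 else 0) + (if m \<le> K - 1 \<and> K - 1 \<le> n then 1/6 else 0)
      + (if m \<le> K \<and> K \<le> n then 1/2 else 0)" for m n
    unfolding lam_def sum.distrib by simp
  have "3/4 \<le> \<beta>" if f: "feasible K b U00 R00 U' R' \<beta>" for U00 R00 U' R' \<beta>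
  proof (rule feasible_ge_dual[OF f, where lam = lam])
    show "0 \<le> lam k" for k by (simp add: lam_def)
  qed (use K in \<open>auto simp: sum_lam b_def split: if_splits\<close>)
  then have "3/4 \<le> beta_opt K b"
    unfolding beta_opt_def using feasible_nonempty[OF b] K by (intro cInf_greatest) auto
  moreover have "3/4 \<le> (MAX k\<in>{1..K}. b k + b (K+1-k))"
  proof (rule order_trans)
    show "3/4 \<le> b 1 + b (K+1-1)" using K by (simp add: b_def)
    show "b 1 + b (K+1-1) \<le> (MAX k\<in>{1..K}. b k + b (K+1-k))"
      using K by (intro Max_ge) (auto intro!: image_eqI[where x = 1])
  qed
  ultimately have "3/4 \<le> objective K b" by (simp add: objective_def)
  also have "\<dots> \<le> alpha_star K" using alpha_star_is_maximum[of K] K b by auto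
  finally show ?thesis .
qed

theorem theorem5:
  shows "alpha_star 4 \<ge> (5 + sqrt 5) / 10 \<and> alpha_star 6 \<ge> 0.74"
proof -
  have "sqrt 5 \<le> 5/2" by (rule real_le_lsqrt) (auto simp: power2_eq_square)
  then show ?thesis
    using alpha_star_ge_three_quarters[of 4] alpha_star_ge_three_quarters[of 6] by simp
qed

end
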